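(* Let $\mathcal{L}\subset\mathbb{R}^d$ be a full-rank lattice. Let $\mathcal{P},Q\subset\mathbb{R}^d$ be connected sets, each of which is a finite union of convex bodies, such that $$(\mathcal{P}-\mathcal{P})\cap\mathcal{L}=\{0\}\qquad\text{and}\qquad (Q-Q)\cap\mathcal{L}=\{0\},$$ and suppose that $\widehat{\mathbf{1}_{\mathcal{P}}}(\xi)=\widehat{\mathbf{1}_{Q}}(\xi)$ for every $\xi\in\mathcal{L}^*$. If, in addition, $\mathcal{P}=-\mathcal{P}$ and $Q=-Q$, then $\mathcal{P}=Q$.
   Context: A body is a compact subset of $\mathbb{R}^d$ with nonempty interior; a convex body is a body that is convex. For $\mathcal{K}\subset\mathbb{R}^d$, $\mathcal{K}-\mathcal{K}:=\{x-y:x,y\in\mathcal{K}\}$ and $-\mathcal{K}:=\{-x:x\in\mathcal{K}\}$. The dual lattice is $\mathcal{L}^*:=\{\xi\in\mathbb{R}^d:\langle\xi,\ell\rangle\in\mathbb{Z}\text{ for every }\ell\in\mathcal{L}\}$. For a measurable set $\mathcal{K}\subset\mathbb{R}^d$ of finite measure, $\mathbf{1}_{\mathcal{K}}$ is its indicator function and $\widehat{\mathbf{1}_{\mathcal{K}}}(\xi):=\int_{\mathcal{K}}e^{-2\pi i\langle x,\xi\rangle}\,dx$ for $\xi\in\mathbb{R}^d$. *)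

theory Defs
  imports "HOL-Analysis.Analysis"
begin

definition full_rank_lattice :: "(real ^ 'n) set \<Rightarrow> bool" where
  "full_rank_lattice L \<longleftrightarrow>
     (\<exists>B. independent B \<and> span B = UNIV \<and>
          L = {(\<Sum>b\<in>B. of_int (c b) *\<^sub>R b) | c :: real ^ 'n \<Rightarrow> int. True})"

definition dual_lattice :: "(real ^ 'n) set \<Rightarrow> (real ^ 'n) set" where
  "dual_lattice L = {\<xi>. \<forall>l\<in>L. \<xi> \<bullet> l \<in> \<int>}"

definition body :: "(real ^ 'n) set \<Rightarrow> bool" where
  "body K \<longleftrightarrow> compact K \<and> interior K \<noteq> {}"

definition convex_body :: "(real ^ 'n) set \<Rightarrow> bool" where
  "convex_body K \<longleftrightarrow> body K \<and> convex K"

definition finite_union_of_convex_bodies :: "(real ^ 'n) set \<Rightarrow> bool" where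
  "finite_union_of_convex_bodies K \<longleftrightarrow>
     (\<exists>F. finite F \<and> (\<forall>C\<in>F. convex_body C) \<and> K = \<Union>F)"

(* The set K - K of differences; the library's minus on sets is the relative complement. *)
definition difference_set :: "(real ^ 'n) set \<Rightarrow> (real ^ 'n) set" where
  "difference_set K = {x - y | x y. x \<in> K \<and> y \<in> K}"

definition fourier_indicator :: "(real ^ 'n) set \<Rightarrow> real ^ 'n \<Rightarrow> complex" where
  "fourier_indicator K \<xi> =
     (LINT x:K|lebesgue. exp (- 2 * complex_of_real pi * \<i> * complex_of_real (x \<bullet> \<xi>)))"

end

theory Submission
  imports Defs
begin

text \<open>The map taking \<open>x\<close> to the values at \<open>x\<close> of the characters of a basis of the dual lattice
  has kernel \<open>L\<close> and a compact image. Trigonometric polynomials are the polynomials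
  in these values, so by Stone--Weierstrass the Fourier coefficients determine the integrals over
  \<open>P\<close> and \<open>Q\<close> of \<open>x \<mapsto> infdist (E x) (E ` Q)\<close>, where \<open>E\<close> is this map. The integral over \<open>Q\<close> vanishes,
  hence so does the function on \<open>P\<close>, which is the closure of its interior; thus \<open>E ` P \<subseteq> E ` Q\<close>.
  On \<open>Q\<close> the map \<open>E\<close> is injective, so sending \<open>x \<in> P\<close> to its difference with the point of \<open>Q\<close> having
  the same image is a continuous map into \<open>L\<close>, and therefore a constant \<open>l\<close>. By symmetry \<open>2 *\<^sub>R l\<close> is
  a difference of two points of \<open>Q\<close>, so \<open>l = 0\<close>.\<close>

section \<open>Characters and weights with equal moments\<close>

definition character :: "'a::euclidean_space \<Rightarrow> 'a \<Rightarrow> complex" where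
  "character \<xi> x = exp (- 2 * complex_of_real pi * \<i> * complex_of_real (x \<bullet> \<xi>))"

text \<open>The weight \<open>h = 1\<close> recovers the hypothesis on the Fourier coefficients.
  Continuity of \<open>h\<close> is built in so that all integrals over compact sets exist.\<close>

definition equal_moments ::
    "'a::euclidean_space set \<Rightarrow> 'a set \<Rightarrow> 'a set \<Rightarrow> ('a \<Rightarrow> complex) \<Rightarrow> bool" where
  "equal_moments A S T h \<longleftrightarrow> continuous_on UNIV h \<and>
     (\<forall>\<xi>\<in>A. (LINT x:S|lebesgue. h x * character \<xi> x) = (LINT x:T|lebesgue. h x * character \<xi> x))"

text \<open>Equality of all moments is not visibly preserved by products; being a multiplier of
  the functions with equal moments is.\<close>

definition moment_multiplier ::
    "'a::euclidean_space set \<Rightarrow> 'a set \<Rightarrow> 'a set \<Rightarrow> ('a \<Rightarrow> complex) \<Rightarrow> bool" where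
  "moment_multiplier A S T f \<longleftrightarrow>
     (\<forall>h. equal_moments A S T h \<longrightarrow> equal_moments A S T (\<lambda>x. f x * h x))"

lemma continuous_on_character [continuous_intros]:
  "continuous_on S (character \<xi>)"
  unfolding character_def by (intro continuous_intros)

lemma character_add: "character (\<xi> + \<zeta>) x = character \<xi> x * character \<zeta> x"
  by (simp add: character_def inner_add_right mult_exp_exp algebra_simps)

lemma character_uminus: "character (- \<xi>) x = cnj (character \<xi> x)"
  by (simp add: character_def exp_cnj)

lemma character_eq_iff: "character \<xi> x = character \<xi> y \<longleftrightarrow> (x - y) \<bullet> \<xi> \<in> \<int>"
proof -
  have "character \<xi> x = character \<xi> y \<longleftrightarrow>
      (\<exists>n::int. - 2 * pi * (x \<bullet> \<xi>) = - 2 * pi * (y \<bullet> \<xi>) + of_int (2 * n) * pi)"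
    unfolding character_def exp_eq by (simp add: complex_eq_iff)
  \<comment> \<open>The negative exponent of the character reverses the sign of the integer.\<close>
  also have "\<dots> \<longleftrightarrow> (\<exists>n::int. (x - y) \<bullet> \<xi> = of_int (- n))"
  proof (rule ex_cong1)
    fix n :: int
    have "- 2 * pi * (x \<bullet> \<xi>) = - 2 * pi * (y \<bullet> \<xi>) + of_int (2 * n) * pi \<longleftrightarrow>
        2 * pi * ((x - y) \<bullet> \<xi>) = 2 * pi * of_int (- n)"
      by (simp add: inner_diff_left algebra_simps) linarith
    then show "- 2 * pi * (x \<bullet> \<xi>) = - 2 * pi * (y \<bullet> \<xi>) + of_int (2 * n) * pi \<longleftrightarrow>
        (x - y) \<bullet> \<xi> = of_int (- n)"
      by (simp only: mult_cancel_left) simp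
  qed
  also have "\<dots> \<longleftrightarrow> (x - y) \<bullet> \<xi> \<in> \<int>"
    by (metis Ints_cases Ints_of_int minus_minus)
  finally show ?thesis .
qed

lemma set_integrable_compact:
  fixes f :: "'a::euclidean_space \<Rightarrow> 'b::{banach, second_countable_topology}"
  assumes "compact S" "continuous_on S f"
  shows "set_integrable lebesgue S f"
  using borel_integrable_compact[OF assms]
  by (simp add: set_integrable_def integrable_completion)

text \<open>Continuous weights are integrable over compact sets, so the integrals split over the
  sum.\<close>

lemma equal_moments_add:
  assumes "compact S" "compact T" "equal_moments A S T f" "equal_moments A S T g"
  shows "equal_moments A S T (\<lambda>x. f x + g x)"
proof -
  have "set_integrable lebesgue C (\<lambda>x. h x * character \<xi> x)"
    if "compact C" "equal_moments A S T h" for C h \<xi>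
    using that unfolding equal_moments_def
    by (intro set_integrable_compact continuous_intros) (auto intro: continuous_on_subset)
  then show ?thesis
    using assms
    by (auto simp: equal_moments_def distrib_right set_integral_add intro!: continuous_intros)
qed

lemma equal_moments_cmult:
  assumes "equal_moments A S T f"
  shows "equal_moments A S T (\<lambda>x. c * f x)"
  using assms by (auto simp: equal_moments_def mult.assoc intro!: continuous_intros)

lemma moment_multiplier_const: "moment_multiplier A S T (\<lambda>x. c)"
  by (simp add: moment_multiplier_def equal_moments_cmult)

lemma moment_multiplier_add:
  assumes "compact S" "compact T" "moment_multiplier A S T f" "moment_multiplier A S T g"
  shows "moment_multiplier A S T (\<lambda>x. f x + g x)"
  using assms by (simp add: moment_multiplier_def equal_moments_add distrib_right)

lemma moment_multiplier_mult:
  assumes "moment_multiplier A S T f" "moment_multiplier A S T g"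
  shows "moment_multiplier A S T (\<lambda>x. f x * g x)"
  using assms by (simp add: moment_multiplier_def mult.assoc)

lemma moment_multiplier_sum:
  assumes "compact S" "compact T" "\<And>i. i \<in> I \<Longrightarrow> moment_multiplier A S T (f i)"
  shows "moment_multiplier A S T (\<lambda>x. \<Sum>i\<in>I. f i x)"
  using assms(3)
  by (induction I rule: infinite_finite_induct)
     (simp_all add: moment_multiplier_const moment_multiplier_add assms(1,2))

text \<open>Multiplying a weight by \<open>character \<zeta>\<close> shifts its moments by
  \<open>\<zeta>\<close>, and the shifted frequencies stay in \<open>A\<close>.\<close>

lemma moment_multiplier_character:
  assumes "\<zeta> \<in> A" "\<And>\<xi>. \<xi> \<in> A \<Longrightarrow> \<xi> + \<zeta> \<in> A"
  shows "moment_multiplier A S T (character \<zeta>)"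
  unfolding moment_multiplier_def equal_moments_def
proof (intro allI impI conjI ballI)
  fix h \<xi>
  assume h: "continuous_on UNIV h \<and> (\<forall>\<xi>\<in>A. (LINT x:S|lebesgue. h x * character \<xi> x)
      = (LINT x:T|lebesgue. h x * character \<xi> x))"
  then show "continuous_on UNIV (\<lambda>x. character \<zeta> x * h x)"
    by (auto intro!: continuous_intros)
  assume "\<xi> \<in> A"
  with h assms(2) have "(LINT x:S|lebesgue. h x * character (\<xi> + \<zeta>) x)
      = (LINT x:T|lebesgue. h x * character (\<xi> + \<zeta>) x)"
    by blast
  then show "(LINT x:S|lebesgue. character \<zeta> x * h x * character \<xi> x)
      = (LINT x:T|lebesgue. character \<zeta> x * h x * character \<xi> x)"
    by (simp add: character_add ac_simps)
qed

section \<open>The torus map and integrals of functions composed with it\<close>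

text \<open>For a basis \<open>\<xi>\<close> of the dual lattice this embeds the quotient torus. The
  target is a Euclidean space, where real polynomials and \<open>infdist\<close> are
  available.\<close>

definition torus_map :: "('n \<Rightarrow> 'a::euclidean_space) \<Rightarrow> 'a \<Rightarrow> complex ^ 'n" where
  "torus_map \<xi> x = (\<chi> i. character (\<xi> i) x)"

lemma continuous_on_torus_map [continuous_intros]:
  "continuous_on S (torus_map \<xi>)"
  unfolding torus_map_def by (intro continuous_intros)

lemma torus_map_eq_iff:
  "torus_map \<xi> x = torus_map \<xi> y \<longleftrightarrow> (\<forall>i. (x - y) \<bullet> \<xi> i \<in> \<int>)"
  by (simp add: torus_map_def vec_eq_iff character_eq_iff)

text \<open>Over the reals, the vectors \<open>axis i 1\<close> and \<open>axis i \<i>\<close> form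
  a basis of \<open>complex ^ 'n\<close>.\<close>

lemma linear_complex_vector_expansion:
  fixes p :: "complex ^ 'n \<Rightarrow> real"
  assumes "linear p"
  shows "p z = (\<Sum>i\<in>UNIV. Re (z $ i) * p (axis i 1) + Im (z $ i) * p (axis i \<i>))"
proof -
  have "z = (\<Sum>i\<in>UNIV. Re (z $ i) *\<^sub>R axis i 1 + Im (z $ i) *\<^sub>R axis i \<i>)"
    by (simp add: vec_eq_iff axis_def if_distrib complex_eq_iff sum.distrib cong: if_cong)
  then have "p z = p (\<Sum>i\<in>UNIV. Re (z $ i) *\<^sub>R axis i 1 + Im (z $ i) *\<^sub>R axis i \<i>)"
    by simp
  then show ?thesis
    by (simp add: linear_sum[OF assms] linear_add[OF assms] linear_cmul[OF assms])
qed

text \<open>Multipliers are closed under sums and products, so induction on the polynomial leaves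
  only the real-linear functions, which are combinations of characters and their conjugates.\<close>

lemma moment_multiplier_polynomial:
  fixes \<xi> :: "'n::finite \<Rightarrow> 'a::euclidean_space"
  assumes p: "real_polynomial_function p"
    and S: "compact S" "compact T"
    and A: "\<And>\<zeta> \<eta>. \<zeta> \<in> A \<Longrightarrow> \<eta> \<in> A \<Longrightarrow> \<zeta> + \<eta> \<in> A" "\<And>\<zeta>. \<zeta> \<in> A \<Longrightarrow> - \<zeta> \<in> A"
    and \<xi>: "\<And>i. \<xi> i \<in> A"
  shows "moment_multiplier A S T (\<lambda>x. complex_of_real (p (torus_map \<xi> x)))"
  using p
proof induction
  case (linear p)
  \<comment> \<open>This is \<open>a * Re z + b * Im z = (a - \<i> * b) / 2 * z + (a + \<i> * b) / 2
    * cnj z\<close> in each coordinate; the conjugate is the character of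
    \<open>- \<xi> i\<close>.\<close>
  have "complex_of_real (p (torus_map \<xi> x)) =
      (\<Sum>i\<in>UNIV. Complex (p (axis i 1) / 2) (- p (axis i \<i>) / 2) * character (\<xi> i) x +
         Complex (p (axis i 1) / 2) (p (axis i \<i>) / 2) * character (- \<xi> i) x)" for x
    unfolding linear_complex_vector_expansion[OF bounded_linear.linear[OF linear],
        of "torus_map \<xi> x"] of_real_sum
    by (intro sum.cong refl) (simp add: torus_map_def character_uminus complex_eq_iff)
  then show ?case
    by (simp only:)
      (intro moment_multiplier_sum moment_multiplier_add moment_multiplier_mult
        moment_multiplier_const moment_multiplier_character S A \<xi>)
next
  case (const c)
  show ?case by (rule moment_multiplier_const)
next
  case (add f g)
  then show ?case by (simp add: moment_multiplier_add S)
next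
  case (mult f g)
  then show ?case by (simp add: moment_multiplier_mult)
qed

text \<open>The polynomial multiplies the weight 1, which has equal moments by \<open>eq\<close>;
  the moment at frequency 0 is the plain integral.\<close>

lemma integral_polynomial_torus_map_eq:
  fixes \<xi> :: "'n::finite \<Rightarrow> 'a::euclidean_space"
  assumes p: "real_polynomial_function p"
    and S: "compact S" "compact T"
    and A: "\<And>\<zeta> \<eta>. \<zeta> \<in> A \<Longrightarrow> \<eta> \<in> A \<Longrightarrow> \<zeta> + \<eta> \<in> A" "\<And>\<zeta>. \<zeta> \<in> A \<Longrightarrow> - \<zeta> \<in> A" "0 \<in> A"
    and \<xi>: "\<And>i. \<xi> i \<in> A"
    and eq: "\<And>\<zeta>. \<zeta> \<in> A \<Longrightarrow>
      (LINT x:S|lebesgue. character \<zeta> x) = (LINT x:T|lebesgue. character \<zeta> x)"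
  shows "(LINT x:S|lebesgue. p (torus_map \<xi> x)) = (LINT x:T|lebesgue. p (torus_map \<xi> x))"
proof -
  have "equal_moments A S T (\<lambda>x. 1)"
    by (simp add: equal_moments_def eq)
  then have "equal_moments A S T (\<lambda>x. complex_of_real (p (torus_map \<xi> x)))"
    using moment_multiplier_polynomial[OF p S A(1,2) \<xi>]
    by (force simp: moment_multiplier_def)
  with \<open>0 \<in> A\<close> have "(LINT x:S|lebesgue. complex_of_real (p (torus_map \<xi> x))) =
      (LINT x:T|lebesgue. complex_of_real (p (torus_map \<xi> x)))"
    by (force simp: equal_moments_def character_def)
  then show ?thesis
    by (simp only: set_integral_complex_of_real of_real_eq_iff)
qed

text \<open>On the compact image of \<open>S \<union> T\<close>, Stone--Weierstrass approximates
  \<open>f\<close> uniformly by polynomials, whose integrals over \<open>S\<close> and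
  \<open>T\<close> agree.\<close>

lemma integral_torus_map_eq:
  fixes \<xi> :: "'n::finite \<Rightarrow> 'a::euclidean_space" and f :: "complex ^ 'n \<Rightarrow> real"
  assumes f: "continuous_on UNIV f"
    and S: "compact S" "compact T"
    and A: "\<And>\<zeta> \<eta>. \<zeta> \<in> A \<Longrightarrow> \<eta> \<in> A \<Longrightarrow> \<zeta> + \<eta> \<in> A" "\<And>\<zeta>. \<zeta> \<in> A \<Longrightarrow> - \<zeta> \<in> A" "0 \<in> A"
    and \<xi>: "\<And>i. \<xi> i \<in> A"
    and eq: "\<And>\<zeta>. \<zeta> \<in> A \<Longrightarrow>
      (LINT x:S|lebesgue. character \<zeta> x) = (LINT x:T|lebesgue. character \<zeta> x)"
  shows "(LINT x:S|lebesgue. f (torus_map \<xi> x)) = (LINT x:T|lebesgue. f (torus_map \<xi> x))"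
proof -
  define I where "I C g = (LINT x:C|lebesgue. g (torus_map \<xi> x))" for C and g :: "complex ^ 'n \<Rightarrow> real"
  have int: "set_integrable lebesgue C (\<lambda>x. g (torus_map \<xi> x))"
    if "compact C" "continuous_on UNIV g" for C and g :: "complex ^ 'n \<Rightarrow> real"
    using that
    by (intro set_integrable_compact continuous_on_compose2[OF that(2)] continuous_intros) auto
  define m where "m = measure lebesgue S + measure lebesgue T"
  have "m \<ge> 0"
    by (simp add: m_def)
  \<comment> \<open>Replacing \<open>f\<close> by a polynomial within \<open>e\<close> changes each
    integral by at most \<open>e\<close> times the measure of its domain.\<close>
  have "\<bar>I S f - I T f\<bar> \<le> e * m" if "e > 0" for e
  proof -
    have "compact (torus_map \<xi> ` (S \<union> T))"
      using S by (intro compact_continuous_image continuous_intros compact_Un)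
    then obtain g where "polynomial_function g"
      and g: "\<And>z. z \<in> torus_map \<xi> ` (S \<union> T) \<Longrightarrow> norm (f z - g z) < e"
      using Stone_Weierstrass_polynomial_function[of "torus_map \<xi> ` (S \<union> T)" f e] f \<open>e > 0\<close>
      by (metis continuous_on_subset subset_UNIV)
    then have poly: "real_polynomial_function g"
      by (simp add: real_polynomial_function_eq)
    have cont: "continuous_on UNIV g"
      using \<open>polynomial_function g\<close> by (rule continuous_on_polymonial_function)
    have close: "\<bar>I C f - I C g\<bar> \<le> e * measure lebesgue C" if "compact C" "C \<subseteq> S \<union> T" for C
    proof -
      let ?d = "\<lambda>x. f (torus_map \<xi> x) - g (torus_map \<xi> x)"
      have d: "set_integrable lebesgue C ?d"
        using int[OF that(1) f] int[OF that(1) cont] by (rule set_integral_diff(1))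
      have "I C f - I C g = (LINT x:C|lebesgue. ?d x)"
        unfolding I_def using int[OF that(1) f] int[OF that(1) cont]
        by (simp add: set_integral_diff(2))
      moreover have "\<bar>LINT x:C|lebesgue. ?d x\<bar> \<le> (LINT x:C|lebesgue. \<bar>?d x\<bar>)"
        using set_integral_norm_bound[OF d] by simp
      moreover have "(LINT x:C|lebesgue. \<bar>?d x\<bar>) \<le> (LINT x:C|lebesgue. e)"
      proof (rule set_integral_mono)
        show "set_integrable lebesgue C (\<lambda>x. \<bar>?d x\<bar>)"
          using d by (rule set_integrable_abs)
        show "set_integrable lebesgue C (\<lambda>x. e)"
          using that(1) by (intro set_integrable_compact continuous_intros)
        show "\<bar>?d x\<bar> \<le> e" if "x \<in> C" for x
          using g[of "torus_map \<xi> x"] that \<open>C \<subseteq> S \<union> T\<close> by force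
      qed
      moreover have "(LINT x:C|lebesgue. e) = e * measure lebesgue C"
        using lmeasurable_compact[OF that(1)]
        by (simp add: set_lebesgue_integral_def mult.commute fmeasurableD)
      ultimately show ?thesis by simp
    qed
    have "I S g = I T g"
      unfolding I_def by (rule integral_polynomial_torus_map_eq[OF poly S A \<xi> eq])
    with close[of S] close[of T] S show ?thesis
      by (simp add: m_def distrib_left)
  qed
  then have "\<bar>I S f - I T f\<bar> \<le> e" if "e > 0" for e
  proof -
    \<comment> \<open>The denominator \<open>m + 1\<close> stays positive even when both sets are
      null.\<close>
    have "e / (m + 1) > 0" using that \<open>m \<ge> 0\<close> by simp
    from \<open>\<And>e. e > 0 \<Longrightarrow> \<bar>I S f - I T f\<bar> \<le> e * m\<close>[OF this]
    have "\<bar>I S f - I T f\<bar> \<le> e * (m / (m + 1))" by simp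
    also have "\<dots> \<le> e * 1"
      using that \<open>m \<ge> 0\<close> by (intro mult_left_mono) auto
    finally show ?thesis by simp
  qed
  then have "\<bar>I S f - I T f\<bar> \<le> 0"
    by (rule field_le_epsilon[where y = 0, simplified])
  then show ?thesis
    by (simp add: I_def)
qed

section \<open>From equal integrals to inclusion of images\<close>

text \<open>A nonnegative function with integral 0 vanishes almost everywhere. Its nonzero points in
  the interior form an open negligible set, which is empty; continuity carries the zero to the
  closure.\<close>

lemma set_integral_continuous_eq_0_imp_eq_0:
  fixes f :: "'a::euclidean_space \<Rightarrow> real"
  assumes S: "compact S" "S \<subseteq> closure (interior S)"
    and f: "continuous_on UNIV f" "\<And>x. f x \<ge> 0"
    and eq0: "(LINT x:S|lebesgue. f x) = 0"
    and x: "x \<in> S"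
  shows "f x = 0"
proof -
  have "integrable lebesgue (\<lambda>x. indicator S x *\<^sub>R f x)"
    using set_integrable_compact[OF S(1) continuous_on_subset[OF f(1)]]
    by (simp add: set_integrable_def)
  then have "AE x in lebesgue. indicator S x *\<^sub>R f x = 0"
    using integral_nonneg_eq_0_iff_AE[of lebesgue "\<lambda>x. indicator S x *\<^sub>R f x"] eq0 f(2)
    by (simp add: set_lebesgue_integral_def)
  then have "negligible {x. indicator S x *\<^sub>R f x \<noteq> 0}"
    unfolding eventually_ae_filter_negligible by (metis (mono_tags, lifting) negligible_subset)
  then have "negligible (interior S \<inter> {x. f x \<noteq> 0})"
    by (rule negligible_subset) (use interior_subset in \<open>auto simp: indicator_def\<close>)
  moreover have "open (interior S \<inter> {x. f x \<noteq> 0})"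
    using f(1) by (intro open_Int open_interior open_Collect_neq continuous_intros)
  ultimately have "interior S \<inter> {x. f x \<noteq> 0} = {}"
    using open_not_negligible by blast
  then have "f y = 0" if "y \<in> interior S" for y
    using that by blast
  with S(2) x show ?thesis
    using continuous_constant_on_closure[of "interior S" f 0 x]
      continuous_on_subset[OF f(1)] by blast
qed

text \<open>The distance to the image of \<open>T\<close> serves as test function: it vanishes on
  that image, and since the image is closed, a zero of it is a point of the image.\<close>

lemma torus_map_image_subset:
  fixes \<xi> :: "'n::finite \<Rightarrow> 'a::euclidean_space"
  assumes S: "compact S" "compact T" "S \<subseteq> closure (interior S)" "T \<noteq> {}"
    and A: "\<And>\<zeta> \<eta>. \<zeta> \<in> A \<Longrightarrow> \<eta> \<in> A \<Longrightarrow> \<zeta> + \<eta> \<in> A" "\<And>\<zeta>. \<zeta> \<in> A \<Longrightarrow> - \<zeta> \<in> A" "0 \<in> A"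
    and \<xi>: "\<And>i. \<xi> i \<in> A"
    and eq: "\<And>\<zeta>. \<zeta> \<in> A \<Longrightarrow>
      (LINT x:S|lebesgue. character \<zeta> x) = (LINT x:T|lebesgue. character \<zeta> x)"
  shows "torus_map \<xi> ` S \<subseteq> torus_map \<xi> ` T"
proof (rule image_subsetI)
  fix x assume "x \<in> S"
  define f where "f z = infdist z (torus_map \<xi> ` T)" for z
  have f: "continuous_on C f" for C
    unfolding f_def by (intro continuous_intros)
  have "(LINT x:S|lebesgue. f (torus_map \<xi> x)) = (LINT x:T|lebesgue. f (torus_map \<xi> x))"
    by (rule integral_torus_map_eq[OF f S(1,2) A \<xi> eq])
  also have "\<dots> = 0"
    unfolding set_lebesgue_integral_def
    by (rule integral_eq_zero_AE) (auto simp: f_def indicator_def)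
  finally have "f (torus_map \<xi> x) = 0"
    using \<open>x \<in> S\<close> S
    by (intro set_integral_continuous_eq_0_imp_eq_0[where f = "\<lambda>x. f (torus_map \<xi> x)" and S = S]
        continuous_on_compose2[OF f] continuous_intros)
      (auto simp: f_def infdist_nonneg)
  moreover have "closed (torus_map \<xi> ` T)"
    using S by (intro compact_imp_closed compact_continuous_image continuous_intros)
  ultimately show "torus_map \<xi> x \<in> torus_map \<xi> ` T"
    using S(4) by (simp add: f_def in_closed_iff_infdist_zero)
qed

text \<open>Distinct integers are at distance at least 1, so the range is discrete.\<close>

lemma continuous_on_connected_Ints_valued_constant:
  fixes f :: "'a::topological_space \<Rightarrow> real"
  assumes "connected S" "continuous_on S f" "\<And>x. x \<in> S \<Longrightarrow> f x \<in> \<int>"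
  shows "f constant_on S"
proof (rule continuous_discrete_range_constant[OF assms(1,2)])
  fix x assume "x \<in> S"
  show "\<exists>e>0. \<forall>y. y \<in> S \<and> f y \<noteq> f x \<longrightarrow> e \<le> norm (f y - f x)"
    using assms(3) \<open>x \<in> S\<close> Ints_nonzero_abs_ge1[OF Ints_diff]
    by (intro exI[of _ 1]) auto
qed

section \<open>Full-rank lattices and their duals\<close>

text \<open>The \<open>\<xi> i\<close> form the basis dual to a lattice basis \<open>B\<close>:
  pairing with them reads off coordinates, and a vector lies in \<open>L\<close> exactly if its
  coordinates are integers.\<close>

lemma full_rank_lattice_dual_basis:
  fixes L :: "(real ^ 'n) set"
  assumes "full_rank_lattice L"
  obtains \<xi> :: "'n \<Rightarrow> real ^ 'n" where
    "\<And>x. x \<in> L \<longleftrightarrow> (\<forall>i. x \<bullet> \<xi> i \<in> \<int>)"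
    "\<And>x. (\<And>i. x \<bullet> \<xi> i = 0) \<Longrightarrow> x = 0"
proof -
  obtain B where B: "independent B" "span B = UNIV"
    and L: "L = {(\<Sum>b\<in>B. of_int (c b) *\<^sub>R b) | c :: real ^ 'n \<Rightarrow> int. True}"
    using assms by (auto simp: full_rank_lattice_def)
  have "finite B"
    using B(1) by (rule finiteI_independent)
  have "card B = CARD('n)"
    using dim_eq_card[of B UNIV] B by (simp add: dim_UNIV)
  \<comment> \<open>Reindexing \<open>B\<close> by the coordinate type lets the dual basis serve as
    the index family of \<open>torus_map\<close>.\<close>
  then obtain g where g: "bij_betw g (UNIV :: 'n set) B"
    using finite_same_card_bij[of "UNIV :: 'n set" B] \<open>finite B\<close> by auto
  \<comment> \<open>The adjoint of a linear functional, evaluated at 1, is the vector that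
    represents it by the inner product.\<close>
  define \<eta> where "\<eta> b = adjoint (\<lambda>x. representation B x b) 1" for b
  have \<eta>: "x \<bullet> \<eta> b = representation B x b" for x b
  proof -
    have "linear (\<lambda>x. representation B x b)"
      using B by (intro linearI) (simp_all add: representation_add representation_scale)
    from adjoint_works[OF this] show ?thesis
      by (simp add: \<eta>_def)
  qed
  have expand: "(\<Sum>b\<in>B. (x \<bullet> \<eta> b) *\<^sub>R b) = x" for x
    using B \<open>finite B\<close> by (simp add: \<eta> sum_representation_eq)
  have all_B: "(\<forall>i. R (g i)) \<longleftrightarrow> (\<forall>b\<in>B. R b)" for R
    using bij_betw_imp_surj_on[OF g] by auto
  show thesis
  proof (rule that[of "\<lambda>i. \<eta> (g i)"])
    fix x
    show "x \<in> L \<longleftrightarrow> (\<forall>i. x \<bullet> \<eta> (g i) \<in> \<int>)"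
      unfolding all_B[where R = "\<lambda>b. x \<bullet> \<eta> b \<in> \<int>"]
    proof
      assume "x \<in> L"
      then obtain c :: "real ^ 'n \<Rightarrow> int" where x: "x = (\<Sum>b\<in>B. of_int (c b) *\<^sub>R b)"
        by (auto simp: L)
      have "x \<bullet> \<eta> b = of_int (c b)" if "b \<in> B" for b
      proof -
        have "a \<bullet> \<eta> b = (if a = b then 1 else 0)" if "a \<in> B" for a
          using that B \<open>b \<in> B\<close> by (simp add: \<eta> representation_basis)
        then have "x \<bullet> \<eta> b = (\<Sum>a\<in>B. of_int (c a) * (if a = b then 1 else 0))"
          by (simp add: x inner_sum_left)
        then show ?thesis
          using \<open>finite B\<close> that by (simp add: if_distrib cong: if_cong)
      qed
      then show "\<forall>b\<in>B. x \<bullet> \<eta> b \<in> \<int>" by simp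
    next
      assume "\<forall>b\<in>B. x \<bullet> \<eta> b \<in> \<int>"
      \<comment> \<open>Integer coordinates equal their floors, and the floor is an integer
        coefficient function defined on the whole space.\<close>
      then have "x = (\<Sum>b\<in>B. of_int \<lfloor>x \<bullet> \<eta> b\<rfloor> *\<^sub>R b)"
        by (subst expand[of x, symmetric], intro sum.cong) (auto elim: Ints_cases)
      then show "x \<in> L"
        unfolding L by (intro CollectI exI[of _ "\<lambda>b. \<lfloor>x \<bullet> \<eta> b\<rfloor>"]) simp
    qed
  next
    fix x assume "\<And>i. x \<bullet> \<eta> (g i) = 0"
    then have "\<forall>b\<in>B. x \<bullet> \<eta> b = 0"
      using all_B[where R = "\<lambda>b. x \<bullet> \<eta> b = 0"] by blast
    then show "x = 0"
      using expand[of x] by simp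
  qed
qed

lemma full_rank_lattice_add:
  assumes "full_rank_lattice L" "x \<in> L" "y \<in> L"
  shows "x + y \<in> L"
proof (rule full_rank_lattice_dual_basis[OF assms(1)])
  fix \<xi> :: "'a \<Rightarrow> real ^ 'a"
  assume "\<And>x. x \<in> L \<longleftrightarrow> (\<forall>i. x \<bullet> \<xi> i \<in> \<int>)"
  with assms(2,3) show "x + y \<in> L"
    by (simp add: inner_add_left)
qed

lemma dual_lattice_add: "\<xi> \<in> dual_lattice L \<Longrightarrow> \<zeta> \<in> dual_lattice L \<Longrightarrow> \<xi> + \<zeta> \<in> dual_lattice L"
  by (simp add: dual_lattice_def inner_add_left)

lemma dual_lattice_uminus: "\<xi> \<in> dual_lattice L \<Longrightarrow> - \<xi> \<in> dual_lattice L"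
  by (simp add: dual_lattice_def)

lemma dual_lattice_zero: "0 \<in> dual_lattice L"
  by (simp add: dual_lattice_def)

section \<open>Topology of finite unions of convex bodies\<close>

lemma finite_union_of_convex_bodies_compact:
  "finite_union_of_convex_bodies K \<Longrightarrow> compact K"
  by (auto simp: finite_union_of_convex_bodies_def convex_body_def body_def intro: compact_Union)

text \<open>A convex set with nonempty interior has the same closure as its interior, and the
  interior of each piece lies in that of the union.\<close>

lemma finite_union_of_convex_bodies_subset_closure_interior:
  assumes "finite_union_of_convex_bodies K"
  shows "K \<subseteq> closure (interior K)"
proof
  fix x assume "x \<in> K"
  with assms obtain C where C: "convex_body C" "C \<subseteq> K" "x \<in> C"
    by (auto simp: finite_union_of_convex_bodies_def)
  then have "x \<in> closure (interior C)"
    using closure_subset[of C] convex_closure_interior[of C]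
    by (auto simp: convex_body_def body_def)
  with C(2) show "x \<in> closure (interior K)"
    by (meson closure_mono interior_mono subsetD)
qed

section \<open>The translation by a lattice vector and its vanishing\<close>

lemma subset_translate_of_fourier_indicator_eq:
  fixes L P Q :: "(real ^ 'n) set"
  assumes L: "full_rank_lattice L"
    and P: "connected P" "finite_union_of_convex_bodies P"
    and Q: "compact Q" "Q \<noteq> {}" "difference_set Q \<inter> L \<subseteq> {0}"
    and fourier: "\<forall>\<xi>\<in>dual_lattice L. fourier_indicator P \<xi> = fourier_indicator Q \<xi>"
  obtains l where "l \<in> L" "\<And>x. x \<in> P \<Longrightarrow> x - l \<in> Q"
proof -
  obtain \<xi> :: "'n \<Rightarrow> real ^ 'n" where \<xi>: "\<And>x. x \<in> L \<longleftrightarrow> (\<forall>i. x \<bullet> \<xi> i \<in> \<int>)"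
    and sep: "\<And>x. (\<And>i. x \<bullet> \<xi> i = 0) \<Longrightarrow> x = 0"
    using full_rank_lattice_dual_basis[OF L] by blast
  have eq_iff: "torus_map \<xi> x = torus_map \<xi> y \<longleftrightarrow> x - y \<in> L" for x y
    by (simp add: torus_map_eq_iff \<xi>)
  have "\<xi> i \<in> dual_lattice L" for i
    using \<xi> by (simp add: dual_lattice_def inner_commute)
  moreover have "(LINT x:P|lebesgue. character \<zeta> x) = (LINT x:Q|lebesgue. character \<zeta> x)"
    if "\<zeta> \<in> dual_lattice L" for \<zeta>
    using fourier that by (simp add: fourier_indicator_def character_def)
  ultimately have sub: "torus_map \<xi> ` P \<subseteq> torus_map \<xi> ` Q"
    using torus_map_image_subset[OF finite_union_of_convex_bodies_compact[OF P(2)] Q(1)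
        finite_union_of_convex_bodies_subset_closure_interior[OF P(2)] Q(2)
        dual_lattice_add dual_lattice_uminus dual_lattice_zero]
    by blast
  have inj: "inj_on (torus_map \<xi>) Q"
  proof (rule inj_onI)
    fix x y assume "x \<in> Q" "y \<in> Q" "torus_map \<xi> x = torus_map \<xi> y"
    then have "x - y \<in> difference_set Q \<inter> L"
      by (auto simp: eq_iff difference_set_def)
    with Q(3) show "x = y" by auto
  qed
  \<comment> \<open>Each point of \<open>P\<close> is congruent modulo \<open>L\<close> to exactly
    one point of \<open>Q\<close>, and \<open>s\<close> selects it.\<close>
  define s where "s x = inv_into Q (torus_map \<xi>) (torus_map \<xi> x)" for x
  have sQ: "s x \<in> Q" and sL: "x - s x \<in> L" if "x \<in> P" for x
    using that sub by (auto simp: s_def inv_into_into f_inv_into_f image_subset_iff simp flip: eq_iff)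
  \<comment> \<open>A continuous injection on a compact set is a homeomorphism onto its
    image.\<close>
  have "continuous_on (torus_map \<xi> ` Q) (inv_into Q (torus_map \<xi>))"
    using inj by (intro continuous_on_inv Q(1) continuous_intros) simp
  then have s: "continuous_on P s"
    unfolding s_def by (rule continuous_on_compose2[OF _ _ sub]) (intro continuous_intros)
  show thesis
  proof (cases "P = {}")
    case True
    show thesis by (rule that[of 0]) (simp_all add: \<xi> True)
  next
    case False
    then obtain a where "a \<in> P" by blast
    have "x - s x = a - s a" if "x \<in> P" for x
    proof -
      \<comment> \<open>The coordinates of a lattice vector are integers, so each is constant on the
        connected set \<open>P\<close>.\<close>
      have "(x - s x) \<bullet> \<xi> i = (a - s a) \<bullet> \<xi> i" for i
      proof -
        have "(\<lambda>x. (x - s x) \<bullet> \<xi> i) constant_on P"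
          using sL \<xi> P(1) s
          by (intro continuous_on_connected_Ints_valued_constant continuous_intros) auto
        with that \<open>a \<in> P\<close> show ?thesis
          unfolding constant_on_def by metis
      qed
      then have "(x - s x) - (a - s a) = 0"
        by (intro sep) (simp add: inner_diff_left[of "x - s x"])
      then show ?thesis by simp
    qed
    then have "s x = x - (a - s a)" if "x \<in> P" for x
      using that by (metis diff_diff_eq2 add_diff_cancel_left')
    then show thesis
      using that[of "a - s a"] sL sQ \<open>a \<in> P\<close> by metis
  qed
qed

text \<open>Applying the translation to \<open>x\<close> and to \<open>- x\<close> puts both
  \<open>x - l\<close> and \<open>x + l\<close> in \<open>Q\<close>. Their difference
  \<open>2 *\<^sub>R l\<close> lies in \<open>L\<close>, which forces \<open>l = 0\<close>.\<close>

lemma subset_of_fourier_indicator_eq: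
  fixes L P Q :: "(real ^ 'n) set"
  assumes "full_rank_lattice L"
    and "connected P" "finite_union_of_convex_bodies P"
    and "compact Q" "Q \<noteq> {}" and Q: "difference_set Q \<inter> L \<subseteq> {0}"
    and "\<forall>\<xi>\<in>dual_lattice L. fourier_indicator P \<xi> = fourier_indicator Q \<xi>"
    and P_sym: "P = uminus ` P" and Q_sym: "Q = uminus ` Q"
  shows "P \<subseteq> Q"
proof
  fix x assume "x \<in> P"
  obtain l where "l \<in> L" and l: "\<And>x. x \<in> P \<Longrightarrow> x - l \<in> Q"
    using subset_translate_of_fourier_indicator_eq[OF assms(1-7)] by blast
  have "- x \<in> P"
    by (subst P_sym) (rule imageI[OF \<open>x \<in> P\<close>])
  then have "- (- x - l) \<in> Q"
    by (subst Q_sym) (intro imageI l)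
  moreover have "- (- x - l) = x + l"
    by simp
  ultimately have "x + l \<in> Q"
    by metis
  with l[OF \<open>x \<in> P\<close>] have "(x + l) - (x - l) \<in> difference_set Q"
    unfolding difference_set_def by blast
  moreover have "(x + l) - (x - l) \<in> L"
    using full_rank_lattice_add[OF assms(1) \<open>l \<in> L\<close> \<open>l \<in> L\<close>] by simp
  ultimately have "(x + l) - (x - l) = 0"
    using Q by blast
  then have "2 *\<^sub>R l = 0"
    by (simp add: scaleR_2)
  with \<open>x + l \<in> Q\<close> show "x \<in> Q" by simp
qed

theorem mainTheorem3:
  fixes L P Q :: "(real ^ 'n) set"
  assumes "full_rank_lattice L"
    and "connected P" and "finite_union_of_convex_bodies P"
    and "connected Q" and "finite_union_of_convex_bodies Q"
    and "difference_set P \<inter> L = {0}"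
    and "difference_set Q \<inter> L = {0}"
    and "\<forall>\<xi>\<in>dual_lattice L. fourier_indicator P \<xi> = fourier_indicator Q \<xi>"
    and "P = uminus ` P" and "Q = uminus ` Q"
  shows "P = Q"
proof
  \<comment> \<open>The difference set of the empty set is empty and so cannot contain 0.\<close>
  have nonempty: "P \<noteq> {}" "Q \<noteq> {}"
    using assms(6,7) by (auto simp: difference_set_def)
  have compact: "compact P" "compact Q"
    using assms(3,5) by (auto intro: finite_union_of_convex_bodies_compact)
  have swapped: "\<forall>\<xi>\<in>dual_lattice L. fourier_indicator Q \<xi> = fourier_indicator P \<xi>"
    by (simp add: assms(8))
  show "P \<subseteq> Q"
    by (rule subset_of_fourier_indicator_eq[OF assms(1-3) compact(2) nonempty(2)
          equalityD1[OF assms(7)] assms(8-10)])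
  show "Q \<subseteq> P"
    by (rule subset_of_fourier_indicator_eq[OF assms(1,4,5) compact(1) nonempty(1)
          equalityD1[OF assms(6)] swapped assms(10,9)])
qed

end
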